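(* Let $E$ and $F$ be Banach lattices. Let $T: E \to F$ be an order bounded linear operator and let $A \subset E$ be an almost limited solid set. If $F$ has property (d), then $T(A)$ is an almost limited subset of $F$.
   Context: All Banach spaces and Banach lattices are real; $E'$ denotes the topological dual of $E$, a Banach lattice with the dual order. A sequence $(f_n)$ in a Banach lattice is disjoint if $|f_n| \wedge |f_m| = 0$ for $n \neq m$. A Banach lattice $F$ has property (d) if $|f_n| \to 0$ in the weak* topology for every disjoint weak* null sequence $(f_n) \subset F'$. A bounded subset $A$ of a Banach lattice $E$ is almost limited if every disjoint weak* null sequence $(f_n)$ in $E'$ converges uniformly to zero on $A$, i.e. $\sup_{x \in A} |f_n(x)| \to 0$. A set $A \subset E$ is solid if $|y| \leq |x|$ with $x \in A$ implies $y \in A$. A linear operator $T: E \to F$ is order bounded if it maps order bounded subsets of $E$ to order bounded subsets of $F$. *)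

theory Defs
  imports "HOL-Analysis.Analysis" "HOL-Library.Lattice_Algebras"
begin

section \<open>Banach lattices\<close>

class banach_lattice = banach + ordered_real_vector + lattice_ab_group_add_abs +
  assumes norm_mono_abs: "\<bar>x\<bar> \<le> \<bar>y\<bar> \<Longrightarrow> norm x \<le> norm y"

instance real :: banach_lattice
  by standard simp

definition solid :: "'a::banach_lattice set \<Rightarrow> bool"
  where "solid A \<longleftrightarrow> (\<forall>x\<in>A. \<forall>y. \<bar>y\<bar> \<le> \<bar>x\<bar> \<longrightarrow> y \<in> A)"

definition order_bounded :: "'a::banach_lattice set \<Rightarrow> bool"
  where "order_bounded S \<longleftrightarrow> (\<exists>a b. S \<subseteq> {a..b})"

text \<open>No norm continuity is required of an order bounded operator.\<close>
definition order_bounded_operator :: "('a::banach_lattice \<Rightarrow> 'b::banach_lattice) \<Rightarrow> bool"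
  where "order_bounded_operator T \<longleftrightarrow>
    linear T \<and> (\<forall>S. order_bounded S \<longrightarrow> order_bounded (T ` S))"


section \<open>The dual Banach lattice\<close>

text \<open>The type \<open>'a \<Rightarrow>\<^sub>L real\<close> cannot be made an instance of a lattice class (the codomain of
  \<open>\<Rightarrow>\<^sub>L\<close> would have to be arbitrary), so the lattice operations of the dual order are defined
  explicitly, as least upper and greatest lower bounds. The interpretation
  \<open>dual\<close> below shows that these bounds exist.\<close>

type_synonym 'a dual = "'a \<Rightarrow>\<^sub>L real"

definition dual_le :: "'a::banach_lattice dual \<Rightarrow> 'a dual \<Rightarrow> bool"
  where "dual_le f g \<longleftrightarrow> (\<forall>x\<ge>0. blinfun_apply f x \<le> blinfun_apply g x)"

definition dual_less :: "'a::banach_lattice dual \<Rightarrow> 'a dual \<Rightarrow> bool"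
  where "dual_less f g \<longleftrightarrow> dual_le f g \<and> \<not> dual_le g f"

definition dual_sup :: "'a::banach_lattice dual \<Rightarrow> 'a dual \<Rightarrow> 'a dual"
  where "dual_sup f g =
    (THE h. dual_le f h \<and> dual_le g h \<and> (\<forall>k. dual_le f k \<and> dual_le g k \<longrightarrow> dual_le h k))"

definition dual_inf :: "'a::banach_lattice dual \<Rightarrow> 'a dual \<Rightarrow> 'a dual"
  where "dual_inf f g =
    (THE h. dual_le h f \<and> dual_le h g \<and> (\<forall>k. dual_le k f \<and> dual_le k g \<longrightarrow> dual_le k h))"

definition dual_abs :: "'a::banach_lattice dual \<Rightarrow> 'a dual"
  where "dual_abs f = dual_sup f (- f)"

lemma dual_le_antisym:
  assumes "dual_le f g" "dual_le g f"
  shows "f = g"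
proof (rule blinfun_eqI)
  fix x
  have *: "blinfun_apply f y = blinfun_apply g y" if "0 \<le> y" for y
    using assms that unfolding dual_le_def by (meson order_antisym)
  have "blinfun_apply f (pprt x - pprt (- x)) = blinfun_apply g (pprt x - pprt (- x))"
    by (simp only: blinfun.diff_right *[OF zero_le_pprt])
  then show "blinfun_apply f x = blinfun_apply g x"
    by (simp add: pprt_neg prts[symmetric])
qed

text \<open>Riesz--Kantorovich: the positive part of \<open>f\<close> is \<open>x \<mapsto> sup {f y | 0 \<le> y \<le> x}\<close> on
  the positive cone.\<close>

lemma dual_pos_part_exists:
  fixes f :: "'a::banach_lattice dual"
  shows "\<exists>h. dual_le 0 h \<and> dual_le f h \<and> (\<forall>k. dual_le 0 k \<and> dual_le f k \<longrightarrow> dual_le h k)"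
proof -
  define p where "p x = (SUP y\<in>{0..x}. blinfun_apply f y)" for x
  have bnd: "blinfun_apply f y \<le> norm f * norm x" if "y \<in> {0..x}" for x y
  proof -
    have "\<bar>y\<bar> \<le> \<bar>x\<bar>" using that by (auto intro: order_trans)
    then have "norm f * norm y \<le> norm f * norm x"
      by (intro mult_left_mono norm_mono_abs) auto
    with norm_blinfun[of f y] show ?thesis by auto
  qed
  have bdd: "bdd_above (blinfun_apply f ` {0..x})" for x
    using bnd by (intro bdd_aboveI[where M="norm f * norm x"]) auto
  have p_upper: "blinfun_apply f y \<le> p x" if "0 \<le> y" "y \<le> x" for x y
    unfolding p_def using that by (intro cSUP_upper bdd) auto
  have p_least: "p x \<le> c" if "0 \<le> x" "\<And>y. 0 \<le> y \<Longrightarrow> y \<le> x \<Longrightarrow> blinfun_apply f y \<le> c" for x c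
    unfolding p_def using that by (intro cSUP_least) auto
  have p_nonneg: "0 \<le> p x" if "0 \<le> x" for x
    using p_upper[of 0 x] that by (simp add: blinfun.zero_right)
  have p_norm: "p x \<le> norm f * norm x" if "0 \<le> x" for x
    using that bnd by (intro p_least) auto
  have p_add: "p (a + b) = p a + p b" if a: "0 \<le> a" and b: "0 \<le> b" for a b
  proof (rule order_antisym)
    show "p (a + b) \<le> p a + p b"
    proof (rule p_least)
      fix y assume y: "0 \<le> y" "y \<le> a + b"
      have "y - inf y a = sup 0 (y - a)"
        by (simp add: diff_inf_eq_sup add_sup_distrib_left)
      moreover have "sup 0 (y - a) \<le> b"
        using y b by (simp add: algebra_simps)
      ultimately have "blinfun_apply f (y - inf y a) \<le> p b"
        by (intro p_upper) (auto simp: le_infI1)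
      moreover have "blinfun_apply f (inf y a) \<le> p a"
        using y a by (intro p_upper) auto
      ultimately show "blinfun_apply f y \<le> p a + p b"
        by (simp add: blinfun.diff_right del: diff_inf_eq_sup)
    qed (use a b in simp)
    have sum: "blinfun_apply f y + blinfun_apply f z \<le> p (a + b)"
      if "0 \<le> y" "y \<le> a" "0 \<le> z" "z \<le> b" for y z
      using p_upper[of "y + z" "a + b"] that
      by (simp add: blinfun.add_right add_mono)
    have sum': "p b \<le> p (a + b) - blinfun_apply f y" if "0 \<le> y" "y \<le> a" for y
    proof (rule p_least[OF b])
      fix z assume "0 \<le> z" "z \<le> b"
      with sum[of y z] that show "blinfun_apply f z \<le> p (a + b) - blinfun_apply f y"
        by simp
    qed
    have "p a \<le> p (a + b) - p b"
    proof (rule p_least[OF a])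
      fix y assume "0 \<le> y" "y \<le> a"
      with sum'[of y] show "blinfun_apply f y \<le> p (a + b) - p b"
        by simp
    qed
    then show "p a + p b \<le> p (a + b)" by simp
  qed
  have p_scale_le: "c * p x \<le> p (c *\<^sub>R x)" if "0 < c" "0 \<le> x" for c x
  proof -
    have "p x \<le> p (c *\<^sub>R x) / c"
    proof (rule p_least)
      fix y assume "0 \<le> y" "y \<le> x"
      then have "blinfun_apply f (c *\<^sub>R y) \<le> p (c *\<^sub>R x)"
        using that by (intro p_upper) (auto intro: scaleR_left_mono scaleR_nonneg_nonneg)
      then show "blinfun_apply f y \<le> p (c *\<^sub>R x) / c"
        using that by (simp add: blinfun.scaleR_right field_simps)
    qed (use that in simp)
    then show ?thesis using that by (simp add: field_simps)
  qed
  have p_scale: "p (c *\<^sub>R x) = c * p x" if "0 \<le> c" "0 \<le> x" for c x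
  proof (cases "c = 0")
    case True
    then show ?thesis using p_add[of 0 0] by simp
  next
    case False
    with that have c: "0 < c" by simp
    have "0 \<le> c *\<^sub>R x" using that by (simp add: scaleR_nonneg_nonneg)
    with p_scale_le[of "inverse c" "c *\<^sub>R x"] c have "p (c *\<^sub>R x) \<le> c * p x"
      by (simp add: field_simps)
    with p_scale_le[of c x] c that show ?thesis by simp
  qed
  define h where "h z = p (pprt z) - p (pprt (- z))" for z
  have split: "z = pprt z - pprt (- z)" for z :: 'a
    by (simp add: pprt_neg prts[symmetric])
  have h_diff: "h (a - b) = p a - p b" if "0 \<le> a" "0 \<le> b" for a b
  proof -
    have "pprt (a - b) + b = a + pprt (- (a - b))"
      using split[of "a - b"] by (simp add: algebra_simps)
    then have "p (pprt (a - b)) + p b = p a + p (pprt (- (a - b)))"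
      using that by (metis p_add zero_le_pprt)
    then show ?thesis by (simp add: h_def)
  qed
  have h_cone: "h x = p x" if "0 \<le> x" for x
    using h_diff[of x 0] that p_add[of 0 0] by simp
  have "bounded_linear h"
  proof (rule bounded_linear_intro)
    fix z w :: 'a and c :: real
    have "z + w = (pprt z + pprt w) - (pprt (- z) + pprt (- w))"
      using split[of z] split[of w] by (metis add_diff_add)
    then have "h (z + w) = p (pprt z + pprt w) - p (pprt (- z) + pprt (- w))"
      by (metis h_diff add_nonneg_nonneg zero_le_pprt)
    then show "h (z + w) = h z + h w"
      by (simp add: p_add[OF zero_le_pprt zero_le_pprt] h_def)
    show "h (c *\<^sub>R z) = c *\<^sub>R h z"
    proof (cases "0 \<le> c")
      case True
      have "c *\<^sub>R z = c *\<^sub>R pprt z - c *\<^sub>R pprt (- z)"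
        using split[of z] by (metis scaleR_diff_right)
      with True have "h (c *\<^sub>R z) = p (c *\<^sub>R pprt z) - p (c *\<^sub>R pprt (- z))"
        by (metis h_diff scaleR_nonneg_nonneg zero_le_pprt)
      also have "\<dots> = c * p (pprt z) - c * p (pprt (- z))"
        using True by (simp only: p_scale[OF _ zero_le_pprt])
      finally show ?thesis by (simp add: h_def algebra_simps)
    next
      case False
      have "c *\<^sub>R z = (- c) *\<^sub>R pprt (- z) - (- c) *\<^sub>R pprt z"
        using split[of z] by (metis minus_diff_eq scaleR_diff_right scaleR_minus_left scaleR_minus_right)
      with False have "h (c *\<^sub>R z) = p ((- c) *\<^sub>R pprt (- z)) - p ((- c) *\<^sub>R pprt z)"
        by (metis h_diff linear neg_0_le_iff_le scaleR_nonneg_nonneg zero_le_pprt)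
      also have "\<dots> = (- c) * p (pprt (- z)) - (- c) * p (pprt z)"
        using False by (simp only: p_scale[OF _ zero_le_pprt])
      finally show ?thesis by (simp add: h_def algebra_simps)
    qed
    have pn: "norm (pprt v) \<le> norm v" for v :: 'a
    proof (rule norm_mono_abs)
      show "\<bar>pprt v\<bar> \<le> \<bar>v\<bar>"
        by (simp add: abs_of_nonneg abs_prts[of v])
    qed
    have "p (pprt v) \<le> norm f * norm v" for v
      using p_norm[OF zero_le_pprt, of v] mult_left_mono[OF pn[of v], of "norm f"] by simp
    from this[of z] this[of "- z"] p_nonneg[OF zero_le_pprt, of z] p_nonneg[OF zero_le_pprt, of "- z"]
    show "norm (h z) \<le> norm z * norm f"
      by (simp add: h_def mult.commute)
  qed
  then have app: "blinfun_apply (Blinfun h) = h"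
    by (rule bounded_linear_Blinfun_apply)
  show ?thesis
  proof (intro exI[of _ "Blinfun h"] conjI allI impI)
    show "dual_le 0 (Blinfun h)" "dual_le f (Blinfun h)"
      using p_nonneg p_upper by (auto simp: dual_le_def app h_cone)
    fix k :: "'a dual" assume k: "dual_le 0 k \<and> dual_le f k"
    show "dual_le (Blinfun h) k"
      unfolding dual_le_def app
    proof (intro allI impI)
      fix x :: 'a assume x: "0 \<le> x"
      have "blinfun_apply f y \<le> blinfun_apply k x" if "0 \<le> y" "y \<le> x" for y
      proof -
        have "blinfun_apply f y \<le> blinfun_apply k y" "0 \<le> blinfun_apply k (x - y)"
          using k that by (auto simp: dual_le_def)
        then show ?thesis by (simp add: blinfun.diff_right)
      qed
      with x show "h x \<le> blinfun_apply k x"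
        by (simp add: h_cone p_least)
    qed
  qed
qed

lemma dual_le_shift: "dual_le (f + k) (g + k) \<longleftrightarrow> dual_le f g"
  by (simp add: dual_le_def blinfun.add_left)

lemma dual_le_uminus: "dual_le (- f) (- g) \<longleftrightarrow> dual_le g f"
  by (simp add: dual_le_def blinfun.minus_left)

lemma dual_lub_exists:
  fixes f g :: "'a::banach_lattice dual"
  shows "\<exists>h. dual_le f h \<and> dual_le g h \<and> (\<forall>k. dual_le f k \<and> dual_le g k \<longrightarrow> dual_le h k)"
proof -
  obtain h where h: "dual_le 0 h" "dual_le (g - f) h"
    "\<And>k. dual_le 0 k \<Longrightarrow> dual_le (g - f) k \<Longrightarrow> dual_le h k"
    using dual_pos_part_exists[of "g - f"] by blast
  show ?thesis
  proof (intro exI[of _ "h + f"] conjI allI impI)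
    show "dual_le f (h + f)" "dual_le g (h + f)"
      using h(1,2) dual_le_shift[of 0 f h] dual_le_shift[of "g - f" f h] by simp_all
    fix k assume "dual_le f k \<and> dual_le g k"
    then have "dual_le h (k - f)"
      using dual_le_shift[of 0 f "k - f"] dual_le_shift[of "g - f" f "k - f"]
      by (intro h(3)) simp_all
    then show "dual_le (h + f) k"
      using dual_le_shift[of h f "k - f"] by simp
  qed
qed

lemma dual_glb_exists:
  fixes f g :: "'a::banach_lattice dual"
  shows "\<exists>h. dual_le h f \<and> dual_le h g \<and> (\<forall>k. dual_le k f \<and> dual_le k g \<longrightarrow> dual_le k h)"
proof -
  obtain h where h: "dual_le (- f) h" "dual_le (- g) h"
    "\<And>k. dual_le (- f) k \<Longrightarrow> dual_le (- g) k \<Longrightarrow> dual_le h k"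
    using dual_lub_exists[of "- f" "- g"] by blast
  show ?thesis
  proof (intro exI[of _ "- h"] conjI allI impI)
    show "dual_le (- h) f" "dual_le (- h) g"
      using h(1,2) dual_le_uminus[of h "- f"] dual_le_uminus[of h "- g"] by simp_all
    fix k assume "dual_le k f \<and> dual_le k g"
    then have "dual_le h (- k)"
      by (intro h(3)) (simp_all add: dual_le_uminus)
    then show "dual_le k (- h)"
      using dual_le_uminus[of "- k" h] by simp
  qed
qed

lemma dual_sup_lub:
  "dual_le f (dual_sup f g) \<and> dual_le g (dual_sup f g) \<and>
    (\<forall>k. dual_le f k \<and> dual_le g k \<longrightarrow> dual_le (dual_sup f g) k)"
  unfolding dual_sup_def
  by (rule theI', rule ex_ex1I[OF dual_lub_exists]) (blast intro: dual_le_antisym)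

lemma dual_inf_glb:
  "dual_le (dual_inf f g) f \<and> dual_le (dual_inf f g) g \<and>
    (\<forall>k. dual_le k f \<and> dual_le k g \<longrightarrow> dual_le k (dual_inf f g))"
  unfolding dual_inf_def
  by (rule theI', rule ex_ex1I[OF dual_glb_exists]) (blast intro: dual_le_antisym)

interpretation dual: lattice dual_inf dual_le dual_less dual_sup
proof
  fix f g h :: "'a dual"
  show "dual_less f g \<longleftrightarrow> dual_le f g \<and> \<not> dual_le g f"
    by (simp add: dual_less_def)
  show "dual_le f f"
    by (simp add: dual_le_def)
  show "dual_le f h" if "dual_le f g" "dual_le g h"
    using that unfolding dual_le_def by (meson order_trans)
  show "f = g" if "dual_le f g" "dual_le g f"
    using that by (rule dual_le_antisym)
qed (use dual_sup_lub dual_inf_glb in blast)+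


section \<open>Weak* null and disjoint sequences\<close>

text \<open>For real-valued functionals, pointwise (strong operator) convergence is weak*
  convergence.\<close>

abbreviation weak_star_topology :: "'a::banach_lattice dual topology"
  where "weak_star_topology \<equiv> strong_operator_topology"

definition weak_star_null :: "(nat \<Rightarrow> 'a::banach_lattice dual) \<Rightarrow> bool"
  where "weak_star_null f \<longleftrightarrow> limitin weak_star_topology f 0 sequentially"

definition dual_disjoint_seq :: "(nat \<Rightarrow> 'a::banach_lattice dual) \<Rightarrow> bool"
  where "dual_disjoint_seq f \<longleftrightarrow>
    (\<forall>n m. n \<noteq> m \<longrightarrow> dual_inf (dual_abs (f n)) (dual_abs (f m)) = 0)"

definition property_d :: "'a::banach_lattice itself \<Rightarrow> bool"
  where "property_d TYPE('a) \<longleftrightarrow>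
    (\<forall>f :: nat \<Rightarrow> 'a dual. dual_disjoint_seq f \<and> weak_star_null f \<longrightarrow>
      weak_star_null (\<lambda>n. dual_abs (f n)))"

text \<open>Uniform convergence is used instead of \<open>(SUP x\<in>A. \<bar>f n x\<bar>) \<longlonglongrightarrow> 0\<close> because the real
  supremum over \<open>A = {}\<close> is unspecified. For nonempty \<open>A\<close> both agree, see
  \<open>uniform_limit_iff_SUP\<close>.\<close>

definition almost_limited :: "'a::banach_lattice set \<Rightarrow> bool"
  where "almost_limited A \<longleftrightarrow> bounded A \<and>
    (\<forall>f :: nat \<Rightarrow> 'a dual. dual_disjoint_seq f \<and> weak_star_null f \<longrightarrow>
      uniform_limit A (\<lambda>n x. blinfun_apply (f n) x) (\<lambda>x. 0) sequentially)"

lemma weak_star_null_iff: "weak_star_null f \<longleftrightarrow> (\<forall>x. (\<lambda>n. blinfun_apply (f n) x) \<longlonglongrightarrow> 0)"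
proof
  assume "weak_star_null f"
  then have "limitin euclidean ((\<lambda>g. blinfun_apply g x) \<circ> f) (blinfun_apply 0 x) sequentially" for x
    unfolding weak_star_null_def
    by (intro continuous_map_limit[OF strong_operator_topology_continuous_evaluation])
  then show "\<forall>x. (\<lambda>n. blinfun_apply (f n) x) \<longlonglongrightarrow> 0"
    by (simp add: o_def)
next
  assume *: "\<forall>x. (\<lambda>n. blinfun_apply (f n) x) \<longlonglongrightarrow> 0"
  have lim: "((\<lambda>n. blinfun_apply (f n)) \<longlongrightarrow> blinfun_apply 0) sequentially"
    unfolding limitin_canonical_iff[symmetric] euclidean_product_topology[symmetric] limitin_componentwise
    using * by simp
  show "weak_star_null f"
    unfolding weak_star_null_def limitin_def strong_operator_topology_topspace
  proof (intro conjI allI impI)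
    fix U :: "'a dual set"
    assume U: "openin weak_star_topology U \<and> 0 \<in> U"
    then obtain V where "open V" "U = blinfun_apply -` V"
      unfolding strong_operator_topology_def openin_pullback_topology by auto
    with U topological_tendstoD[OF lim, of V] show "\<forall>\<^sub>F n in sequentially. f n \<in> U"
      by simp
  qed simp
qed

lemma uniform_limit_iff_SUP:
  fixes f :: "nat \<Rightarrow> 'a::banach_lattice dual"
  assumes "bounded A" "A \<noteq> {}"
  shows "uniform_limit A (\<lambda>n x. blinfun_apply (f n) x) (\<lambda>x. 0) sequentially \<longleftrightarrow>
    (\<lambda>n. SUP x\<in>A. \<bar>blinfun_apply (f n) x\<bar>) \<longlonglongrightarrow> 0"
proof -
  define s where "s n = (SUP x\<in>A. \<bar>blinfun_apply (f n) x\<bar>)" for n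
  obtain B where B: "\<And>x. x \<in> A \<Longrightarrow> norm x \<le> B"
    using assms by (auto simp: bounded_iff)
  have bnd: "\<bar>blinfun_apply (f n) x\<bar> \<le> norm (f n) * B" if "x \<in> A" for n x
    using norm_blinfun[of "f n" x] mult_left_mono[OF B[OF that], of "norm (f n)"] by simp
  have bdd: "bdd_above ((\<lambda>x. \<bar>blinfun_apply (f n) x\<bar>) ` A)" for n
    using bnd by (intro bdd_aboveI[where M="norm (f n) * B"]) auto
  have upper: "\<bar>blinfun_apply (f n) x\<bar> \<le> s n" if "x \<in> A" for n x
    unfolding s_def using bdd that by (intro cSUP_upper)
  have nonneg: "0 \<le> s n" for n
    using assms(2) upper by (meson abs_ge_zero all_not_in_conv order_trans)
  have least: "s n \<le> e" if "\<And>x. x \<in> A \<Longrightarrow> \<bar>blinfun_apply (f n) x\<bar> \<le> e" for n e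
    unfolding s_def using assms(2) that by (intro cSUP_least)
  have "uniform_limit A (\<lambda>n x. blinfun_apply (f n) x) (\<lambda>x. 0) sequentially \<longleftrightarrow> s \<longlonglongrightarrow> 0"
  proof
    assume L: "uniform_limit A (\<lambda>n x. blinfun_apply (f n) x) (\<lambda>x. 0) sequentially"
    show "s \<longlonglongrightarrow> 0"
    proof (rule tendstoI)
      fix e :: real assume e: "0 < e"
      with L have "\<forall>\<^sub>F n in sequentially. \<forall>x\<in>A. dist (blinfun_apply (f n) x) 0 < e / 2"
        by (intro uniform_limitD) auto
      then show "\<forall>\<^sub>F n in sequentially. dist (s n) 0 < e"
      proof eventually_elim
        case (elim n)
        then have "s n \<le> e / 2" by (intro least) (auto simp: less_imp_le)
        with e nonneg[of n] show ?case by simp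
      qed
    qed
  next
    assume L: "s \<longlonglongrightarrow> 0"
    show "uniform_limit A (\<lambda>n x. blinfun_apply (f n) x) (\<lambda>x. 0) sequentially"
    proof (rule uniform_limitI)
      fix e :: real assume "0 < e"
      with L have "\<forall>\<^sub>F n in sequentially. dist (s n) 0 < e" by (rule tendstoD)
      then show "\<forall>\<^sub>F n in sequentially. \<forall>x\<in>A. dist (blinfun_apply (f n) x) 0 < e"
        by eventually_elim (use upper nonneg in \<open>auto intro: le_less_trans\<close>)
    qed
  qed
  then show ?thesis by (simp add: s_def[abs_def])
qed

end

theory Submission
  imports Defs
begin

text \<open>If \<open>f\<^sub>n\<close> is disjoint and weak* null in \<open>F'\<close>, property (d) gives \<open>\<bar>f\<^sub>n\<bar> \<rightarrow> 0\<close> weak*. Since \<open>T\<close> maps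
  \<open>{y. \<bar>y\<bar> \<le> x}\<close> into some \<open>{w. \<bar>w\<bar> \<le> z}\<close>, the moduli of \<open>g\<^sub>n = f\<^sub>n \<circ> T\<close> satisfy \<open>\<bar>g\<^sub>n\<bar> x \<le> \<bar>f\<^sub>n\<bar> z\<close> and
  are weak* null as well, but the \<open>g\<^sub>n\<close> need not be disjoint. If they did not converge
  uniformly on \<open>A\<close>, there would be \<open>x\<^sub>n \<ge> 0\<close> in the solid set \<open>A\<close> with \<open>\<bar>g\<^sub>n\<bar> x\<^sub>n \<ge> \<epsilon>\<close> along a
  subsequence. Thinning out and subtracting overlaps replaces the \<open>x\<^sub>n\<close> by disjoint vectors
  \<open>v\<^sub>n \<le> x\<^sub>n\<close> with \<open>\<bar>g\<^sub>n\<bar> v\<^sub>n \<ge> \<epsilon> / 2\<close>. Restricting the supremum \<open>sup {g\<^sub>n y | \<bar>y\<bar> \<le> x}\<close> to those \<open>y\<close> that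
  lie in the ideal generated by \<open>v\<^sub>n\<close> yields functionals that are disjoint, lie below \<open>\<bar>g\<^sub>n\<bar>\<close>, and
  agree with \<open>\<bar>g\<^sub>n\<bar>\<close> at \<open>v\<^sub>n\<close>, contradicting that \<open>A\<close> is almost limited.\<close>

section \<open>Norm and order\<close>

lemma norm_abs [simp]: "norm \<bar>x\<bar> = norm x" for x :: "'a::banach_lattice"
  by (intro antisym norm_mono_abs) simp_all

lemma abs_le_iff_bounds: "\<bar>y\<bar> \<le> x \<longleftrightarrow> - x \<le> y \<and> y \<le> x" for x y :: "'a::banach_lattice"
  by (metis abs_leI abs_le_D1 abs_le_D2 minus_le_iff)

lemma norm_mono_nonneg: "0 \<le> x \<Longrightarrow> x \<le> y \<Longrightarrow> norm x \<le> norm y" for x y :: "'a::banach_lattice"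
  by (rule norm_mono_abs) (simp add: order_trans[of 0 x y])

text \<open>Since \<open>w - l\<close> lies below \<open>\<bar>s n - l\<bar>\<close>, so does its
  positive part. Monotonicity of the norm then makes the norm of that part smaller than every term
  of a null sequence.\<close>

lemma le_tendsto:
  fixes s :: "nat \<Rightarrow> 'a::banach_lattice"
  assumes "s \<longlonglongrightarrow> l" "\<forall>\<^sub>F n in sequentially. w \<le> s n"
  shows "w \<le> l"
proof -
  have "\<forall>\<^sub>F n in sequentially. norm (pprt (w - l)) \<le> norm (s n - l)"
    using assms(2)
  proof eventually_elim
    case (elim n)
    have "w - l \<le> \<bar>s n - l\<bar>"
      using elim abs_ge_self[of "s n - l"] by (meson diff_right_mono order_trans)
    then have "pprt (w - l) \<le> \<bar>s n - l\<bar>"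
      by (simp add: pprt_def)
    then show ?case
      using norm_mono_nonneg[OF zero_le_pprt] by fastforce
  qed
  moreover have "(\<lambda>n. norm (s n - l)) \<longlonglongrightarrow> 0"
    using assms(1) by (simp add: LIM_zero tendsto_norm_zero)
  ultimately have "norm (pprt (w - l)) \<le> 0"
    by (metis tendsto_lowerbound trivial_limit_sequentially)
  then have "pprt (w - l) = 0"
    by simp
  then show ?thesis
    by (simp flip: le_zero_iff_zero_pprt)
qed

lemma le_suminf:
  fixes f :: "nat \<Rightarrow> 'a::banach_lattice"
  assumes "summable f" "\<And>n. 0 \<le> f n"
  shows "f n \<le> suminf f"
proof (rule le_tendsto[OF summable_LIMSEQ[OF assms(1)]])
  show "\<forall>\<^sub>F m in sequentially. f n \<le> (\<Sum>i<m. f i)"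
    unfolding eventually_sequentially
  proof (intro exI[of _ "Suc n"] allI impI)
    fix m assume "Suc n \<le> m"
    then show "f n \<le> (\<Sum>i<m. f i)"
      using assms(2) sum_mono2[of "{..<m}" "{n}" f] by simp
  qed
qed

text \<open>The two parts are \<open>p\<close> and \<open>0\<close>, both translated by
  \<open>- nprt p\<close>. The infimum is therefore \<open>inf p 0\<close>, which is
  \<open>nprt p\<close>, under the same translation.\<close>

lemma inf_pprt_pprt_uminus: "inf (pprt p) (pprt (- p)) = 0" for p :: "'a::banach_lattice"
proof -
  have "inf (pprt p) (pprt (- p)) = inf (p - nprt p) (0 - nprt p)"
    by (metis add_diff_cancel_right' diff_0 pprt_neg prts)
  also have "\<dots> = inf p 0 - nprt p"
    using add_inf_distrib_right[of p 0 "- nprt p"] by simp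
  also have "\<dots> = 0"
    by (simp add: nprt_def)
  finally show ?thesis .
qed

lemma disjoint_multiples:
  fixes u v w :: "'a::banach_lattice"
  assumes "0 \<le> w" "w \<le> s *\<^sub>R u" "w \<le> t *\<^sub>R v" "0 \<le> u" "0 \<le> v" "inf u v = 0"
  shows "w = 0"
proof -
  \<comment> \<open>A single scalar above both \<open>s\<close> and \<open>t\<close>, whatever their
    signs; the summand 1 makes it invertible.\<close>
  define c where "c = \<bar>s\<bar> + \<bar>t\<bar> + 1"
  have c: "0 < c" by (simp add: c_def)
  have "s *\<^sub>R u \<le> c *\<^sub>R u" "t *\<^sub>R v \<le> c *\<^sub>R v"
    using assms(4,5) by (auto intro!: scaleR_right_mono simp: c_def)
  with assms have "w \<le> c *\<^sub>R u" "w \<le> c *\<^sub>R v"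
    by auto
  then have "inverse c *\<^sub>R w \<le> u" "inverse c *\<^sub>R w \<le> v"
    using c scaleR_left_mono[of w "c *\<^sub>R u" "inverse c"] scaleR_left_mono[of w "c *\<^sub>R v" "inverse c"]
    by simp_all
  then have "inverse c *\<^sub>R w \<le> 0"
    using assms(6) by (metis le_infI)
  then have "w \<le> 0"
    using c scaleR_left_mono[of "inverse c *\<^sub>R w" 0 c] by simp
  with assms(1) show ?thesis by simp
qed

text \<open>The piece \<open>y1\<close> is \<open>y\<close> truncated to the interval from
  \<open>- a\<close> to \<open>a\<close>, and \<open>y2\<close> is what remains. The bounds by
  \<open>\<bar>y\<bar>\<close> keep both pieces in any solid set that contains
  \<open>y\<close>.\<close>

lemma riesz_decomposition:
  fixes y a b :: "'a::banach_lattice"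
  assumes "\<bar>y\<bar> \<le> a + b" "0 \<le> a" "0 \<le> b"
  obtains y1 y2 where "y = y1 + y2" "\<bar>y1\<bar> \<le> a" "\<bar>y1\<bar> \<le> \<bar>y\<bar>" "\<bar>y2\<bar> \<le> b" "\<bar>y2\<bar> \<le> \<bar>y\<bar>"
proof -
  define y1 where "y1 = sup (inf y a) (- a)"
  have y: "y \<le> \<bar>y\<bar>" "- \<bar>y\<bar> \<le> y" "0 \<le> \<bar>y\<bar>" "- \<bar>y\<bar> \<le> 0"
    using abs_ge_self[of y] abs_ge_minus_self[of y] by (simp_all add: minus_le_iff)
  have ab: "y \<le> a + b" "- a - b \<le> y" "- a \<le> 0" "- b \<le> 0" "- a \<le> a"
    using assms by (auto simp: abs_le_iff_bounds minus_le_self_iff)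
  have y2: "y - y1 = inf (sup 0 (y - a)) (y + a)"
    unfolding y1_def by (simp add: diff_sup_eq_inf diff_inf_eq_sup algebra_simps
        add_sup_distrib_left add_inf_distrib_left)
  show thesis
  proof
    show "y = y1 + (y - y1)" by simp
    show "\<bar>y1\<bar> \<le> a"
      unfolding abs_le_iff_bounds y1_def using ab assms by (auto intro: order_trans)
    have "a \<ge> - \<bar>y\<bar>" "- a \<le> \<bar>y\<bar>"
      using y ab assms(2) by (meson order_trans)+
    then show "\<bar>y1\<bar> \<le> \<bar>y\<bar>"
      unfolding abs_le_iff_bounds y1_def using y
      by (auto intro: le_supI1 le_infI1)
    have "y - a \<le> b" "- b \<le> y + a"
      using ab(1) add_right_mono[OF ab(2), of a] by (simp_all add: algebra_simps)
    then show "\<bar>y - y1\<bar> \<le> b"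
      unfolding abs_le_iff_bounds y2 using ab assms(3)
      by (auto intro: le_infI1 le_supI1)
    have "y - a \<le> \<bar>y\<bar>" "- \<bar>y\<bar> \<le> y + a"
      using y assms(2) by (simp_all add: algebra_simps add_increasing add_increasing2)
    then show "\<bar>y - y1\<bar> \<le> \<bar>y\<bar>"
      unfolding abs_le_iff_bounds y2 using y
      by (auto intro: le_infI1 le_supI1)
  qed
qed

text \<open>From \<open>x (Suc k)\<close> a large multiple of all earlier terms is removed, and a
  small multiple of \<open>X\<close>, a weighted sum that dominates the later ones. For
  \<open>j < k\<close> the two results are dominated by multiples of the positive and the negative
  part of one vector \<open>p\<close>, hence are disjoint.\<close>

lemma disjointification:
  fixes x :: "nat \<Rightarrow> 'a::banach_lattice"
  assumes "bounded (range x)" and x: "\<And>n. 0 \<le> x n"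
  obtains X where "0 \<le> X"
    "\<And>j k. j \<noteq> k \<Longrightarrow>
      inf (pprt (x (Suc j) - 4 ^ j *\<^sub>R (\<Sum>i\<le>j. x i) - (1 / 2 ^ j) *\<^sub>R X))
          (pprt (x (Suc k) - 4 ^ k *\<^sub>R (\<Sum>i\<le>k. x i) - (1 / 2 ^ k) *\<^sub>R X)) = 0"
proof -
  define X where "X = (\<Sum>n. (1 / 2 ^ n) *\<^sub>R x n)"
  define v where "v k = pprt (x (Suc k) - 4 ^ k *\<^sub>R (\<Sum>i\<le>k. x i) - (1 / 2 ^ k) *\<^sub>R X)" for k
  obtain B where B: "\<And>n. norm (x n) \<le> B"
    using assms(1) by (auto simp: bounded_iff)
  have summ: "summable (\<lambda>n. (1 / 2 ^ n) *\<^sub>R x n)"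
  proof (rule summable_comparison_test')
    show "summable (\<lambda>n. (1 / 2) ^ n * B)"
      by (intro summable_mult2 summable_geometric) simp
    show "norm ((1 / 2 ^ n) *\<^sub>R x n) \<le> (1 / 2) ^ n * B" for n
      using mult_left_mono[OF B[of n], of "(1/2)^n"] by (simp add: power_divide)
  qed
  have le_X: "(1 / 2 ^ n) *\<^sub>R x n \<le> X" for n
    unfolding X_def by (intro le_suminf[OF summ] scaleR_nonneg_nonneg x) simp
  have X: "0 \<le> X"
    using le_X[of 0] x[of 0] by simp
  have disj: "inf (v j) (v k) = 0" if "j < k" for j k
  proof -
    \<comment> \<open>Two demands meet here: \<open>1 / c\<close> is \<open>1 / 2 ^ j\<close> times
      the weight of \<open>x (Suc k)\<close> in \<open>X\<close>, and \<open>c \<le> 4 ^ k\<close>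
      because \<open>j + Suc k \<le> 2 * k\<close>. Also \<open>Suc j \<le> k\<close>, so
      \<open>x (Suc j)\<close> occurs in the sum subtracted at stage \<open>k\<close>.\<close>
    define c :: real where "c = 2 ^ (j + Suc k)"
    define p where "p = x (Suc j) - (1 / c) *\<^sub>R x (Suc k)"
    have c: "0 < c" by (simp add: c_def)
    have nonneg: "0 \<le> 4 ^ i *\<^sub>R (\<Sum>i\<le>i. x i)" "0 \<le> (1 / 2 ^ i) *\<^sub>R X" for i :: nat
      using X x by (auto intro!: scaleR_nonneg_nonneg sum_nonneg)
    have "(1 / c) *\<^sub>R x (Suc k) \<le> (1 / 2 ^ j) *\<^sub>R X"
      using scaleR_left_mono[OF le_X[of "Suc k"], of "1 / 2 ^ j"]
      by (simp add: c_def power_add mult_ac)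
    then have "x (Suc j) - 4 ^ j *\<^sub>R (\<Sum>i\<le>j. x i) - (1 / 2 ^ j) *\<^sub>R X \<le> p"
      unfolding p_def using nonneg(1)[of j] by (simp add: algebra_simps add_increasing2)
    then have vj: "v j \<le> 1 *\<^sub>R pprt p"
      unfolding v_def by (simp add: pprt_mono)
    have "c \<le> 2 ^ (2 * k)"
      unfolding c_def using that by (intro power_increasing) auto
    then have c4: "c \<le> 4 ^ k"
      by (simp add: power_mult)
    have "c *\<^sub>R x (Suc j) \<le> c *\<^sub>R (\<Sum>i\<le>k. x i)"
      using c that x sum_mono2[of "{..k}" "{Suc j}" x] by (intro scaleR_left_mono) auto
    also have "\<dots> \<le> 4 ^ k *\<^sub>R (\<Sum>i\<le>k. x i)"
      using c4 x by (intro scaleR_right_mono sum_nonneg)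
    finally have "x (Suc k) - 4 ^ k *\<^sub>R (\<Sum>i\<le>k. x i) - (1 / 2 ^ k) *\<^sub>R X \<le> x (Suc k) - c *\<^sub>R x (Suc j)"
      using nonneg(2)[of k] by (simp add: algebra_simps add_increasing add_mono)
    also have "\<dots> = c *\<^sub>R (- p)"
      using c by (simp add: p_def scaleR_diff_right)
    also have "\<dots> \<le> c *\<^sub>R pprt (- p)"
      using c by (intro scaleR_left_mono) (auto simp: pprt_def)
    finally have vk: "v k \<le> c *\<^sub>R pprt (- p)"
      unfolding v_def using c by (subst pprt_def) (auto intro: scaleR_nonneg_nonneg)
    show ?thesis
    proof (rule disjoint_multiples)
      show "0 \<le> inf (v j) (v k)"
        by (simp add: v_def)
      show "inf (v j) (v k) \<le> 1 *\<^sub>R pprt p" "inf (v j) (v k) \<le> c *\<^sub>R pprt (- p)"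
        using vj vk by (auto intro: le_infI1 le_infI2)
    qed (simp_all add: inf_pprt_pprt_uminus)
  qed
  have "inf (v j) (v k) = 0" if "j \<noteq> k" for j k
    using disj[of j k] disj[of k j] that by (cases j k rule: linorder_cases) (auto simp: inf_commute)
  with X show thesis
    unfolding v_def by (rule that)
qed

section \<open>Order bounded operators and automatic continuity\<close>

lemma order_bounded_operator_interval:
  assumes "order_bounded_operator T"
  obtains z where "0 \<le> z" "\<And>y. \<bar>y\<bar> \<le> x \<Longrightarrow> \<bar>T y\<bar> \<le> z"
proof -
  have "order_bounded {- x..x}"
    unfolding order_bounded_def by blast
  then have "order_bounded (T ` {- x..x})"
    using assms by (simp add: order_bounded_operator_def)
  then obtain a b where ab: "T ` {- x..x} \<subseteq> {a..b}"
    unfolding order_bounded_def by blast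
  show thesis
  proof
    \<comment> \<open>The interval between this vector and its negative contains
      \<open>{a..b}\<close>.\<close>
    show "0 \<le> \<bar>a\<bar> + \<bar>b\<bar>" by simp
    fix y assume "\<bar>y\<bar> \<le> x"
    then have "T y \<in> T ` {- x..x}"
      by (simp add: abs_le_iff_bounds)
    with ab have "a \<le> T y" "T y \<le> b"
      by auto
    moreover have "b \<le> \<bar>a\<bar> + \<bar>b\<bar>" "- (\<bar>a\<bar> + \<bar>b\<bar>) \<le> a"
      using abs_ge_minus_self[of a] abs_ge_self[of b] add_mono[of "- a" "\<bar>a\<bar>" 0 "\<bar>b\<bar>"]
      by (simp_all add: add_increasing minus_le_iff[of "\<bar>a\<bar> + \<bar>b\<bar>"] del: minus_add_distrib)
    ultimately show "\<bar>T y\<bar> \<le> \<bar>a\<bar> + \<bar>b\<bar>"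
      unfolding abs_le_iff_bounds by (meson order_trans)
  qed
qed

text \<open>If \<open>T\<close> were unbounded, there would be an absolutely summable sequence
  \<open>y\<close> whose images are unbounded in norm. By completeness the sum of the moduli exists
  and gives one order interval containing all \<open>y n\<close>, and \<open>T\<close> maps that
  interval into a norm bounded set.\<close>

lemma order_bounded_operator_bounded_linear:
  fixes T :: "'a::banach_lattice \<Rightarrow> 'b::banach_lattice"
  assumes "order_bounded_operator T"
  shows "bounded_linear T"
proof -
  interpret linear T
    using assms by (simp add: order_bounded_operator_def)
  have "\<exists>K. \<forall>x. norm (T x) \<le> norm x * K"
  proof (rule ccontr)
    assume neg: "\<not> ?thesis"
    \<comment> \<open>The factor \<open>4 ^ n\<close> is shared out by the scaling below: one
      \<open>2 ^ n\<close> makes \<open>y\<close> summable, the other makes its images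
      unbounded.\<close>
    have "\<exists>x. norm x * (4 ^ n) < norm (T x)" for n :: nat
      using neg by (metis not_le)
    then obtain x where x: "\<And>n. norm (x n) * 4 ^ n < norm (T (x n))"
      by metis
    have x0: "0 < norm (x n)" for n
      using x[of n] zero by (cases "x n = 0") auto
    define y where "y n = (1 / (2 ^ n * norm (x n))) *\<^sub>R x n" for n
    have y: "norm (y n) = (1 / 2) ^ n" "2 ^ n < norm (T (y n))" for n
    proof -
      show "norm (y n) = (1 / 2) ^ n"
        using x0[of n] by (simp add: y_def power_divide)
      have "2 ^ n = (norm (x n) * 4 ^ n) / (2 ^ n * norm (x n))"
        using x0[of n] by (simp add: field_simps flip: power_mult_distrib)
      also have "\<dots> < norm (T (x n)) / (2 ^ n * norm (x n))"
        using x x0[of n] by (intro divide_strict_right_mono) auto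
      finally show "2 ^ n < norm (T (y n))"
        by (simp add: y_def scale)
    qed
    have "summable (\<lambda>n. \<bar>y n\<bar>)"
      by (rule summable_norm_cancel) (simp add: y(1) summable_geometric)
    from le_suminf[OF this] obtain X where X: "\<And>n. \<bar>y n\<bar> \<le> X"
      by auto
    obtain z where z: "0 \<le> z" "\<And>w. \<bar>w\<bar> \<le> X \<Longrightarrow> \<bar>T w\<bar> \<le> z"
      using order_bounded_operator_interval[OF assms] by blast
    have "norm (T (y n)) \<le> norm z" for n
      using z X by (intro norm_mono_abs) simp
    with y(2) have "2 ^ n < norm z" for n
      by (meson order_less_le_trans)
    then show False
      by (metis less_asym one_less_numeral_iff real_arch_pow semiring_norm(76))
  qed
  then show ?thesis
    by unfold_locales
qed


section \<open>The modulus of a functional on an order ideal\<close>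

text \<open>Every vector is a difference of positive ones, and additivity makes
  \<open>p a - p b\<close> depend only on \<open>a - b\<close>. The pair
  \<open>z + \<bar>z\<bar>\<close>, \<open>\<bar>z\<bar>\<close> serves as the representation of
  \<open>z\<close>.\<close>

lemma positive_functional_extension:
  fixes p :: "'a::banach_lattice \<Rightarrow> real"
  assumes add: "\<And>x y. 0 \<le> x \<Longrightarrow> 0 \<le> y \<Longrightarrow> p (x + y) = p x + p y"
    and scale: "\<And>c x. 0 \<le> c \<Longrightarrow> 0 \<le> x \<Longrightarrow> p (c *\<^sub>R x) = c * p x"
    and nonneg: "\<And>x. 0 \<le> x \<Longrightarrow> 0 \<le> p x"
    and bound: "\<And>x. 0 \<le> x \<Longrightarrow> p x \<le> C * norm x"
  obtains h :: "'a dual" where "\<And>x. 0 \<le> x \<Longrightarrow> blinfun_apply h x = p x"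
proof -
  define h where "h z = p (z + \<bar>z\<bar>) - p \<bar>z\<bar>" for z
  have pos: "0 \<le> z + \<bar>z\<bar>" for z :: 'a
    using abs_ge_minus_self[of z] by (metis add.commute diff_ge_0_iff_ge diff_minus_eq_add)
  have h_diff: "h (a - b) = p a - p b" if "0 \<le> a" "0 \<le> b" for a b
  proof -
    let ?z = "a - b"
    have "p (?z + \<bar>?z\<bar>) + p b = p (?z + \<bar>?z\<bar> + b)"
      by (rule add[symmetric]) (use pos that in auto)
    also have "?z + \<bar>?z\<bar> + b = a + \<bar>?z\<bar>"
      by (simp add: algebra_simps)
    also have "p \<dots> = p a + p \<bar>?z\<bar>"
      by (rule add) (use that in auto)
    finally show ?thesis
      by (simp add: h_def)
  qed
  have split: "z = (z + \<bar>z\<bar>) - \<bar>z\<bar>" for z :: 'a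
    by simp
  have "bounded_linear h"
  proof (rule bounded_linear_intro)
    fix z w :: 'a and c :: real
    have "h (z + w) = h ((z + \<bar>z\<bar> + (w + \<bar>w\<bar>)) - (\<bar>z\<bar> + \<bar>w\<bar>))"
      by (simp add: algebra_simps)
    also have "\<dots> = p (z + \<bar>z\<bar> + (w + \<bar>w\<bar>)) - p (\<bar>z\<bar> + \<bar>w\<bar>)"
      by (rule h_diff) (simp_all add: pos add_nonneg_nonneg)
    finally show "h (z + w) = h z + h w"
      by (simp add: h_def add[OF pos pos] add)
    show "h (c *\<^sub>R z) = c *\<^sub>R h z"
    proof (cases "0 \<le> c")
      case True
      have "h (c *\<^sub>R z) = h (c *\<^sub>R (z + \<bar>z\<bar>) - c *\<^sub>R \<bar>z\<bar>)"
        by (simp add: algebra_simps)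
      also have "\<dots> = p (c *\<^sub>R (z + \<bar>z\<bar>)) - p (c *\<^sub>R \<bar>z\<bar>)"
        by (rule h_diff) (use True pos in \<open>simp_all add: scaleR_nonneg_nonneg\<close>)
      also have "\<dots> = c * p (z + \<bar>z\<bar>) - c * p \<bar>z\<bar>"
        by (simp only: scale[OF True pos] scale[OF True abs_ge_zero])
      finally show ?thesis
        by (simp add: h_def algebra_simps)
    next
      case False
      then have c: "0 \<le> - c" by simp
      have "h (c *\<^sub>R z) = h ((- c) *\<^sub>R \<bar>z\<bar> - (- c) *\<^sub>R (z + \<bar>z\<bar>))"
        by (simp add: algebra_simps)
      also have "\<dots> = p ((- c) *\<^sub>R \<bar>z\<bar>) - p ((- c) *\<^sub>R (z + \<bar>z\<bar>))"
        by (rule h_diff; rule scaleR_nonneg_nonneg[OF c]) (simp_all add: pos)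
      also have "\<dots> = (- c) * p \<bar>z\<bar> - (- c) * p (z + \<bar>z\<bar>)"
        by (simp only: scale[OF c pos] scale[OF c abs_ge_zero])
      finally show ?thesis
        by (simp add: h_def algebra_simps)
    qed
    \<comment> \<open>Adding the nonnegative value at \<open>\<bar>z\<bar> - z\<close> completes the
      argument to \<open>3 *\<^sub>R \<bar>z\<bar>\<close>; this is the origin of the factor
      3.\<close>
    have "\<bar>h z\<bar> \<le> p (z + \<bar>z\<bar>) + p \<bar>z\<bar>"
      unfolding h_def using nonneg[OF pos, of z] nonneg[OF abs_ge_zero, of z] by linarith
    also have "\<dots> = p (z + \<bar>z\<bar> + \<bar>z\<bar>)"
      by (simp add: add[OF pos])
    also have "\<dots> \<le> p (z + \<bar>z\<bar> + \<bar>z\<bar>) + p (\<bar>z\<bar> - z)"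
      using nonneg[of "\<bar>z\<bar> - z"] abs_ge_self[of z] by simp
    also have "\<dots> = p (3 *\<^sub>R \<bar>z\<bar>)"
      using pos[of z] abs_ge_self[of z] scaleR_left_distrib[of 1 2 "\<bar>z\<bar>"]
        add_nonneg_nonneg[OF pos abs_ge_zero, of z z]
      by (subst add[symmetric]) (auto simp: algebra_simps scaleR_2)
    also have "\<dots> \<le> norm z * (3 * C)"
      using scale[of 3 "\<bar>z\<bar>"] bound[of "\<bar>z\<bar>"] by (simp add: mult.commute)
    finally show "norm (h z) \<le> norm z * (3 * C)"
      by simp
  qed
  then have "blinfun_apply (Blinfun h) = h"
    by (rule bounded_linear_Blinfun_apply)
  moreover have "h x = p x" if "0 \<le> x" for x
    using h_diff[of x 0] that scale[of 0 0] by simp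
  ultimately show thesis
    using that[of "Blinfun h"] by simp
qed

text \<open>The Riesz-Kantorovich formula for the modulus of \<open>f\<close>, with competitors
  confined to \<open>I\<close>. It is meaningful only for \<open>0 \<le> x\<close>: otherwise the
  supremum is over the empty set.\<close>

definition modulus_on :: "'a::banach_lattice set \<Rightarrow> 'a dual \<Rightarrow> 'a \<Rightarrow> real"
  where "modulus_on I f x = (SUP y\<in>{y\<in>I. \<bar>y\<bar> \<le> x}. blinfun_apply f y)"

lemma modulus_on_upper:
  assumes "y \<in> I" "\<bar>y\<bar> \<le> x"
  shows "blinfun_apply f y \<le> modulus_on I f x"
  unfolding modulus_on_def
proof (rule cSUP_upper)
  show "bdd_above (blinfun_apply f ` {y \<in> I. \<bar>y\<bar> \<le> x})"
  proof (rule bdd_aboveI2)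
    fix y assume "y \<in> {y \<in> I. \<bar>y\<bar> \<le> x}"
    then have "norm y \<le> norm x"
      using norm_mono_nonneg[of "\<bar>y\<bar>" x] by simp
    then have "norm f * norm y \<le> norm f * norm x"
      by (simp add: mult_left_mono)
    then show "blinfun_apply f y \<le> norm f * norm x"
      using norm_blinfun[of f y] by simp
  qed
qed (use assms in simp)

lemma modulus_on_least:
  assumes "0 \<in> I" "0 \<le> x" "\<And>y. y \<in> I \<Longrightarrow> \<bar>y\<bar> \<le> x \<Longrightarrow> blinfun_apply f y \<le> c"
  shows "modulus_on I f x \<le> c"
  unfolding modulus_on_def using assms by (intro cSUP_least) auto

lemma modulus_on_nonneg: "0 \<in> I \<Longrightarrow> 0 \<le> x \<Longrightarrow> 0 \<le> modulus_on I f x"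
  using modulus_on_upper[of 0 I x f] by (simp add: blinfun.zero_right)

lemma modulus_on_mono_set:
  assumes "0 \<in> I" "I \<subseteq> J" "0 \<le> x"
  shows "modulus_on I f x \<le> modulus_on J f x"
  using assms by (intro modulus_on_least modulus_on_upper) auto

text \<open>Subadditivity comes from the Riesz decomposition, whose pieces stay in \<open>I\<close>
  by solidity. Superadditivity comes from adding competitors, which stay in \<open>I\<close> because
  it is a subspace.\<close>

lemma modulus_on_functional:
  fixes f :: "'a::banach_lattice dual"
  assumes "subspace I" "solid I"
  shows "\<exists>h :: 'a dual. \<forall>x\<ge>0. blinfun_apply h x = modulus_on I f x"
proof (rule positive_functional_extension[of "modulus_on I f" "norm f"])
  have 0: "0 \<in> I"
    using assms(1) by (rule subspace_0)
  show "0 \<le> modulus_on I f x" if "0 \<le> x" for x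
    using 0 that by (rule modulus_on_nonneg)
  show "modulus_on I f x \<le> norm f * norm x" if "0 \<le> x" for x
  proof (rule modulus_on_least[OF 0 that])
    fix y assume "\<bar>y\<bar> \<le> x"
    then have "norm f * norm y \<le> norm f * norm x"
      using norm_mono_nonneg[of "\<bar>y\<bar>" x] by (simp add: mult_left_mono)
    then show "blinfun_apply f y \<le> norm f * norm x"
      using norm_blinfun[of f y] by simp
  qed
  show "modulus_on I f (a + b) = modulus_on I f a + modulus_on I f b"
    if ab: "0 \<le> a" "0 \<le> b" for a b
  proof (rule antisym)
    show "modulus_on I f (a + b) \<le> modulus_on I f a + modulus_on I f b"
    proof (rule modulus_on_least[OF 0])
      fix y assume y: "y \<in> I" "\<bar>y\<bar> \<le> a + b"
      obtain y1 y2 where "y = y1 + y2" "\<bar>y1\<bar> \<le> a" "\<bar>y1\<bar> \<le> \<bar>y\<bar>" "\<bar>y2\<bar> \<le> b" "\<bar>y2\<bar> \<le> \<bar>y\<bar>"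
        using riesz_decomposition[OF y(2) ab] by blast
      moreover from this have "y1 \<in> I" "y2 \<in> I"
        using assms(2) y(1) by (auto simp: solid_def)
      ultimately show "blinfun_apply f y \<le> modulus_on I f a + modulus_on I f b"
        by (simp add: blinfun.add_right add_mono modulus_on_upper)
    qed (use ab in simp)
    have "blinfun_apply f y + blinfun_apply f z \<le> modulus_on I f (a + b)"
      if "y \<in> I" "\<bar>y\<bar> \<le> a" "z \<in> I" "\<bar>z\<bar> \<le> b" for y z
      using that assms(1) modulus_on_upper[of "y + z" I "a + b" f]
      by (simp add: blinfun.add_right subspace_add order_trans[OF abs_triangle_ineq add_mono])
    then have "blinfun_apply f z \<le> modulus_on I f (a + b) - blinfun_apply f y"
      if "y \<in> I" "\<bar>y\<bar> \<le> a" "z \<in> I" "\<bar>z\<bar> \<le> b" for y z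
      using that by (simp add: algebra_simps)
    then have "modulus_on I f b \<le> modulus_on I f (a + b) - blinfun_apply f y"
      if "y \<in> I" "\<bar>y\<bar> \<le> a" for y
      using that ab by (intro modulus_on_least[OF 0]) auto
    then have "modulus_on I f a \<le> modulus_on I f (a + b) - modulus_on I f b"
      using ab by (intro modulus_on_least[OF 0]) (auto simp: algebra_simps)
    then show "modulus_on I f a + modulus_on I f b \<le> modulus_on I f (a + b)"
      by simp
  qed
  \<comment> \<open>The reverse inequality follows by applying this one to \<open>inverse c\<close>
    and \<open>c *\<^sub>R x\<close>.\<close>
  have scale_le: "c * modulus_on I f x \<le> modulus_on I f (c *\<^sub>R x)" if "0 < c" "0 \<le> x" for c x
  proof -
    have "modulus_on I f x \<le> modulus_on I f (c *\<^sub>R x) / c"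
    proof (rule modulus_on_least[OF 0 that(2)])
      fix y assume y: "y \<in> I" "\<bar>y\<bar> \<le> x"
      then have "- (c *\<^sub>R x) \<le> c *\<^sub>R y" "c *\<^sub>R y \<le> c *\<^sub>R x"
        using that scaleR_left_mono[of "- x" y c] scaleR_left_mono[of y x c]
        by (auto simp: abs_le_iff_bounds)
      then have "blinfun_apply f (c *\<^sub>R y) \<le> modulus_on I f (c *\<^sub>R x)"
        using y assms(1) by (intro modulus_on_upper) (auto simp: subspace_scale abs_le_iff_bounds)
      with that show "blinfun_apply f y \<le> modulus_on I f (c *\<^sub>R x) / c"
        by (simp add: blinfun.scaleR_right field_simps)
    qed
    with that show ?thesis
      by (simp add: field_simps)
  qed
  show "modulus_on I f (c *\<^sub>R x) = c * modulus_on I f x" if cx: "0 \<le> c" "0 \<le> x" for c x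
  proof (cases "c = 0")
    case True
    have "modulus_on I f 0 \<le> 0"
      by (rule modulus_on_least[OF 0]) (auto simp: blinfun.zero_right)
    with True show ?thesis
      using modulus_on_nonneg[OF 0, of 0 f] by simp
  next
    case False
    with cx have c: "0 < c" by simp
    have "inverse c * modulus_on I f (c *\<^sub>R x) \<le> modulus_on I f x"
      using scale_le[of "inverse c" "c *\<^sub>R x"] c cx by (simp add: scaleR_nonneg_nonneg)
    then have "modulus_on I f (c *\<^sub>R x) \<le> c * modulus_on I f x"
      using c by (simp add: field_simps)
    with scale_le[OF c cx(2)] show ?thesis
      by simp
  qed
qed blast

text \<open>On the cone \<open>dual_abs f\<close> dominates both \<open>f\<close> and
  \<open>- f\<close>. This is applied to the positive and negative parts of \<open>y\<close>, whose
  sum is \<open>\<bar>y\<bar>\<close>.\<close>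

lemma abs_apply_le_dual_abs: "\<bar>blinfun_apply f y\<bar> \<le> blinfun_apply (dual_abs f) \<bar>y\<bar>"
proof -
  have le: "blinfun_apply f w \<le> blinfun_apply (dual_abs f) w"
    "- blinfun_apply f w \<le> blinfun_apply (dual_abs f) w" if "0 \<le> w" for w
    using dual_sup_lub[of f "- f"] that
    by (auto simp: dual_abs_def dual_le_def blinfun.minus_left)
  let ?p = "pprt y" and ?q = "pprt (- y)"
  have "y = ?p - ?q" "\<bar>y\<bar> = ?p + ?q"
    by (simp_all add: pprt_neg prts[symmetric] abs_prts)
  then have "blinfun_apply f y = blinfun_apply f ?p - blinfun_apply f ?q"
    "blinfun_apply (dual_abs f) \<bar>y\<bar> = blinfun_apply (dual_abs f) ?p + blinfun_apply (dual_abs f) ?q"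
    by (metis blinfun.diff_right, metis blinfun.add_right)
  then show ?thesis
    using le[OF zero_le_pprt, of y] le[OF zero_le_pprt, of "- y"] by linarith
qed

lemma dual_abs_nonneg: "0 \<le> x \<Longrightarrow> 0 \<le> blinfun_apply (dual_abs f) x"
  using abs_apply_le_dual_abs[of f x] by (simp add: order_trans[OF abs_ge_zero])

lemma dual_abs_mono: "x \<le> y \<Longrightarrow> blinfun_apply (dual_abs f) x \<le> blinfun_apply (dual_abs f) y"
  using dual_abs_nonneg[of "y - x" f] by (simp add: blinfun.diff_right)

text \<open>This makes the modulus, defined as an abstract least upper bound, computable. The
  functional given by the formula is an upper bound of \<open>f\<close> and \<open>- f\<close>, and
  every competitor in the supremum is controlled by \<open>dual_abs f\<close>.\<close>

lemma dual_abs_eq_modulus_on: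
  assumes "0 \<le> x"
  shows "blinfun_apply (dual_abs f) x = modulus_on UNIV f x"
proof (rule antisym)
  obtain h where h: "\<And>x. 0 \<le> x \<Longrightarrow> blinfun_apply h x = modulus_on UNIV f x"
    using modulus_on_functional[of UNIV f] by (auto simp: solid_def)
  have "dual_le f h" "dual_le (- f) h"
    using modulus_on_upper[of _ UNIV _ f] modulus_on_upper[of "- _" UNIV _ f]
    by (auto simp: dual_le_def h blinfun.minus_left blinfun.minus_right)
  then have "dual_le (dual_abs f) h"
    by (simp add: dual_abs_def)
  with h assms show "blinfun_apply (dual_abs f) x \<le> modulus_on UNIV f x"
    by (simp add: dual_le_def)
  show "modulus_on UNIV f x \<le> blinfun_apply (dual_abs f) x"
  proof (rule modulus_on_least[OF UNIV_I assms])
    fix y assume "\<bar>y\<bar> \<le> x"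
    then show "blinfun_apply f y \<le> blinfun_apply (dual_abs f) x"
      using abs_apply_le_dual_abs[of f y] dual_abs_mono[of "\<bar>y\<bar>" x f] by linarith
  qed
qed

lemma dual_abs_of_nonneg: "dual_le 0 h \<Longrightarrow> dual_abs h = h"
proof -
  assume "dual_le 0 h"
  then have "dual_le (- h) h"
    by (simp add: dual_le_def blinfun.minus_left)
  then show ?thesis
    unfolding dual_abs_def by (rule dual.sup_absorb1)
qed

text \<open>If \<open>f y\<close> nearly attains the modulus at \<open>x\<close>, then the first functional is small on
  \<open>x - \<bar>y\<bar>\<close> and the second one vanishes at \<open>\<bar>y\<bar>\<close>.\<close>
lemma modulus_on_disjoint:
  assumes I: "0 \<in> I" and J: "subspace J" "solid J" and "I \<inter> J \<subseteq> {0}" and "solid I"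
    and h: "\<And>x. 0 \<le> x \<Longrightarrow> blinfun_apply h x = modulus_on I f x"
    and k: "\<And>x. 0 \<le> x \<Longrightarrow> blinfun_apply k x = modulus_on J g x"
  shows "dual_inf (dual_abs h) (dual_abs k) = 0"
proof -
  have J0: "0 \<in> J" using J(1) by (rule subspace_0)
  have nonneg: "dual_le 0 h" "dual_le 0 k"
    using modulus_on_nonneg[OF I] modulus_on_nonneg[OF J0] by (auto simp: dual_le_def h k)
  have "dual_inf h k = 0"
  proof (rule dual_le_antisym)
    show "dual_le 0 (dual_inf h k)"
      using nonneg by simp
    show "dual_le (dual_inf h k) 0"
      unfolding dual_le_def
    proof (intro allI impI)
      fix x :: 'a assume x: "0 \<le> x"
      have inf_le: "blinfun_apply (dual_inf h k) w \<le> blinfun_apply h w"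
        "blinfun_apply (dual_inf h k) w \<le> blinfun_apply k w" if "0 \<le> w" for w
        using dual_inf_glb[of h k] that by (auto simp: dual_le_def)
      have bound: "blinfun_apply f y \<le> blinfun_apply h x - blinfun_apply (dual_inf h k) x"
        if y: "y \<in> I" "\<bar>y\<bar> \<le> x" for y
      proof -
        have "\<bar>y\<bar> \<in> I"
          using \<open>solid I\<close> y(1) by (simp add: solid_def)
        \<comment> \<open>A competitor from \<open>J\<close> below \<open>\<bar>y\<bar>\<close> also
          lies in \<open>I\<close> by solidity, so it is zero.\<close>
        have "modulus_on J g \<bar>y\<bar> \<le> 0"
        proof (rule modulus_on_least[OF J0])
          fix w assume w: "w \<in> J" "\<bar>w\<bar> \<le> \<bar>y\<bar>"
          then have "w \<in> I \<inter> J"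
            using \<open>solid I\<close> y(1) by (auto simp: solid_def)
          with assms(4) show "blinfun_apply g w \<le> 0"
            by (auto simp: blinfun.zero_right)
        qed simp
        then have "blinfun_apply (dual_inf h k) \<bar>y\<bar> \<le> 0"
          using inf_le(2)[of "\<bar>y\<bar>"] k[of "\<bar>y\<bar>"] by simp
        moreover have "blinfun_apply (dual_inf h k) (x - \<bar>y\<bar>) \<le> blinfun_apply h (x - \<bar>y\<bar>)"
          using y by (intro inf_le) simp
        moreover have "blinfun_apply f y \<le> blinfun_apply h \<bar>y\<bar>"
          using y h[of "\<bar>y\<bar>"] by (simp add: modulus_on_upper)
        ultimately show ?thesis
          by (simp add: blinfun.diff_right)
      qed
      have "modulus_on I f x \<le> blinfun_apply h x - blinfun_apply (dual_inf h k) x"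
        using bound by (rule modulus_on_least[OF I x])
      then show "blinfun_apply (dual_inf h k) x \<le> blinfun_apply 0 x"
        by (simp add: h x)
    qed
  qed
  with nonneg show ?thesis
    by (simp add: dual_abs_of_nonneg)
qed

section \<open>Principal ideals\<close>

definition principal_ideal :: "'a::banach_lattice \<Rightarrow> 'a set"
  where "principal_ideal u = {y. \<exists>t\<ge>0. \<bar>y\<bar> \<le> t *\<^sub>R u}"

lemma solid_principal_ideal: "solid (principal_ideal u)"
  by (auto simp: solid_def principal_ideal_def intro: order_trans)

lemma subspace_principal_ideal: "subspace (principal_ideal u)"
  unfolding subspace_def
proof (intro conjI ballI allI)
  show "0 \<in> principal_ideal u"
    by (auto simp: principal_ideal_def intro: exI[of _ 0])
  show "x + y \<in> principal_ideal u" if "x \<in> principal_ideal u" "y \<in> principal_ideal u" for x y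
  proof -
    obtain s t where "0 \<le> s" "0 \<le> t" "\<bar>x\<bar> \<le> s *\<^sub>R u" "\<bar>y\<bar> \<le> t *\<^sub>R u"
      using \<open>x \<in> _\<close> \<open>y \<in> _\<close> by (auto simp: principal_ideal_def)
    then have "0 \<le> s + t" "\<bar>x + y\<bar> \<le> (s + t) *\<^sub>R u"
      using order_trans[OF abs_triangle_ineq add_mono] by (auto simp: scaleR_left_distrib)
    then show ?thesis
      by (auto simp: principal_ideal_def)
  qed
  show "c *\<^sub>R x \<in> principal_ideal u" if x: "x \<in> principal_ideal u" for c x
  proof -
    obtain t where t: "0 \<le> t" "- (t *\<^sub>R u) \<le> x" "x \<le> t *\<^sub>R u"
      using x by (auto simp: principal_ideal_def abs_le_iff_bounds)
    have "- (\<bar>c\<bar> *\<^sub>R t *\<^sub>R u) \<le> \<bar>c\<bar> *\<^sub>R x" "\<bar>c\<bar> *\<^sub>R x \<le> \<bar>c\<bar> *\<^sub>R t *\<^sub>R u"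
      using scaleR_left_mono[OF t(2), of "\<bar>c\<bar>"] scaleR_left_mono[OF t(3), of "\<bar>c\<bar>"] by auto
    then have "\<bar>\<bar>c\<bar> *\<^sub>R x\<bar> \<le> (\<bar>c\<bar> * t) *\<^sub>R u"
      by (simp add: abs_le_iff_bounds)
    moreover have "\<bar>c *\<^sub>R x\<bar> = \<bar>\<bar>c\<bar> *\<^sub>R x\<bar>"
      by (cases "0 \<le> c") simp_all
    ultimately show ?thesis
      using t(1) by (auto simp: principal_ideal_def intro!: exI[of _ "\<bar>c\<bar> * t"])
  qed
qed

lemma principal_ideal_disjoint:
  assumes "0 \<le> u" "0 \<le> v" "inf u v = 0"
  shows "principal_ideal u \<inter> principal_ideal v \<subseteq> {0}"
proof
  fix y assume "y \<in> principal_ideal u \<inter> principal_ideal v"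
  then obtain s t where "\<bar>y\<bar> \<le> s *\<^sub>R u" "\<bar>y\<bar> \<le> t *\<^sub>R v"
    by (auto simp: principal_ideal_def)
  then have "\<bar>y\<bar> = 0"
    using assms by (intro disjoint_multiples[of "\<bar>y\<bar>" s u t v]) auto
  then show "y \<in> {0}"
    by simp
qed


section \<open>Uniform convergence on solid almost limited sets\<close>

lemma weak_star_null_positive:
  assumes "\<And>x. 0 \<le> x \<Longrightarrow> (\<lambda>n. blinfun_apply (f n) x) \<longlonglongrightarrow> 0"
  shows "weak_star_null f"
  unfolding weak_star_null_iff
proof
  fix x :: 'a
  have "(\<lambda>n. blinfun_apply (f n) (pprt x) - blinfun_apply (f n) (pprt (- x))) \<longlonglongrightarrow> 0 - 0"
    by (intro tendsto_diff assms) auto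
  then have "(\<lambda>n. blinfun_apply (f n) (pprt x - pprt (- x))) \<longlonglongrightarrow> 0"
    by (simp only: blinfun.diff_right diff_zero)
  then show "(\<lambda>n. blinfun_apply (f n) x) \<longlonglongrightarrow> 0"
    by (simp add: pprt_neg prts[symmetric])
qed

text \<open>The \<open>f n\<close> need not be disjoint, so the hypothesis on \<open>A\<close> is
  applied to their moduli restricted to the ideals of the \<open>v n\<close>. These are disjoint as
  the ideals are, and weak* null as they lie below \<open>dual_abs (f n)\<close>.\<close>

lemma almost_limited_disjoint_uniform:
  fixes f :: "nat \<Rightarrow> 'a::banach_lattice dual"
  assumes "almost_limited A" "weak_star_null (\<lambda>n. dual_abs (f n))"
    and v: "\<And>n. v n \<in> A" "\<And>n. 0 \<le> v n" "\<And>m n. m \<noteq> n \<Longrightarrow> inf (v m) (v n) = 0"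
  shows "(\<lambda>n. blinfun_apply (dual_abs (f n)) (v n)) \<longlonglongrightarrow> 0"
proof -
  let ?I = "\<lambda>n. principal_ideal (v n)"
  have I0: "0 \<in> ?I n" for n
    by (rule subspace_0[OF subspace_principal_ideal])
  have "\<exists>h. \<forall>x\<ge>0. blinfun_apply h x = modulus_on (?I n) (f n) x" for n
    using modulus_on_functional[OF subspace_principal_ideal solid_principal_ideal] by metis
  then obtain h where h: "\<And>n x. 0 \<le> x \<Longrightarrow> blinfun_apply (h n) x = modulus_on (?I n) (f n) x"
    by metis
  have "dual_disjoint_seq h"
    unfolding dual_disjoint_seq_def
  proof (intro allI impI)
    fix n m :: nat assume "n \<noteq> m"
    then show "dual_inf (dual_abs (h n)) (dual_abs (h m)) = 0"
      using v(2,3) by (intro modulus_on_disjoint[OF I0 subspace_principal_ideal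
            solid_principal_ideal principal_ideal_disjoint solid_principal_ideal h h])
  qed
  moreover have "weak_star_null h"
  proof (rule weak_star_null_positive)
    fix x :: 'a assume x: "0 \<le> x"
    show "(\<lambda>n. blinfun_apply (h n) x) \<longlonglongrightarrow> 0"
    proof (rule tendsto_sandwich[OF _ _ tendsto_const])
      show "(\<lambda>n. blinfun_apply (dual_abs (f n)) x) \<longlonglongrightarrow> 0"
        using assms(2) by (simp add: weak_star_null_iff)
    qed (use x I0 in \<open>auto simp: h dual_abs_eq_modulus_on intro!: always_eventually
        modulus_on_nonneg modulus_on_mono_set\<close>)
  qed
  ultimately have "uniform_limit A (\<lambda>n x. blinfun_apply (h n) x) (\<lambda>x. 0) sequentially"
    using assms(1) by (simp add: almost_limited_def)
  then have "(\<lambda>n. blinfun_apply (h n) (v n)) \<longlonglongrightarrow> 0"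
    unfolding uniform_limit_iff tendsto_iff using v(1) by (fast elim: eventually_mono)
  moreover have "blinfun_apply (h n) (v n) = blinfun_apply (dual_abs (f n)) (v n)" for n
  proof -
    \<comment> \<open>Below \<open>v n\<close> the ideal imposes no restriction, so nothing is lost
      at this vector.\<close>
    have "{y \<in> ?I n. \<bar>y\<bar> \<le> v n} = {y \<in> UNIV. \<bar>y\<bar> \<le> v n}"
      by (auto simp: principal_ideal_def intro: exI[of _ 1])
    then show ?thesis
      by (simp add: h v(2) dual_abs_eq_modulus_on modulus_on_def)
  qed
  ultimately show ?thesis
    by simp
qed

lemma almost_limited_solid_uniform_limit:
  fixes f :: "nat \<Rightarrow> 'a::banach_lattice dual"
  assumes A: "almost_limited A" "solid A" and f: "weak_star_null (\<lambda>n. dual_abs (f n))"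
  shows "uniform_limit A (\<lambda>n x. blinfun_apply (f n) x) (\<lambda>x. 0) sequentially"
proof (rule ccontr)
  let ?g = "\<lambda>n. blinfun_apply (dual_abs (f n))"
  have g_lim: "(\<lambda>n. ?g n x) \<longlonglongrightarrow> 0" for x
    using f by (simp add: weak_star_null_iff)
  assume "\<not> ?thesis"
  then obtain e where e: "0 < e"
    and "\<not> (\<forall>\<^sub>F n in sequentially. \<forall>x\<in>A. dist (blinfun_apply (f n) x) 0 < e)"
    by (auto simp: uniform_limit_iff)
  then have inf: "\<exists>n>m. \<exists>x\<in>A. e \<le> \<bar>blinfun_apply (f n) x\<bar>" for m
    unfolding eventually_sequentially by simp (meson Suc_le_eq not_le)
  then obtain x0 where "x0 \<in> A"
    by blast
  then have A0: "0 \<in> A"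
    using A(2) by (auto simp: solid_def)
  define P where "P n x \<longleftrightarrow> x \<in> A \<and> 0 \<le> x \<and> e \<le> ?g n x" for n x
  \<comment> \<open>The default 0 belongs to \<open>A\<close> by solidity, so \<open>x n\<close> is
    a nonnegative element of \<open>A\<close> even where no witness exists.\<close>
  define x where "x n = (if \<exists>x. P n x then SOME x. P n x else 0)" for n
  have x: "x n \<in> A" "0 \<le> x n" for n
    using someI_ex[of "P n"] A0 by (auto simp: x_def P_def)
  have ex_P: "\<exists>n>m. e \<le> ?g n (x n)" for m
  proof -
    obtain n y where "n > m" "y \<in> A" "e \<le> \<bar>blinfun_apply (f n) y\<bar>"
      using inf by blast
    then have "P n \<bar>y\<bar>"
      using A(2) abs_apply_le_dual_abs[of "f n" y] by (auto simp: P_def solid_def)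
    then have "P n (x n)"
      unfolding x_def by (metis someI)
    with \<open>n > m\<close> show ?thesis
      by (auto simp: P_def)
  qed
  \<comment> \<open>Each functional tends to 0 at a fixed vector, so the next index can be taken
    late enough to make the coming subtraction cost less than \<open>e / 4\<close>. The choice sees
    only the current index, hence the sum over all \<open>i \<le> r k\<close> instead of the
    selected ones.\<close>
  have "\<exists>r. \<forall>k. True \<and> r k < r (Suc k) \<and> e \<le> ?g (r (Suc k)) (x (r (Suc k))) \<and>
      ?g (r (Suc k)) (4 ^ k *\<^sub>R (\<Sum>i\<le>r k. x i)) < e / 4"
  proof (rule dependent_nat_choice)
    fix m k :: nat
    have "\<forall>\<^sub>F n in sequentially. ?g n (4 ^ k *\<^sub>R (\<Sum>i\<le>m. x i)) < e / 4"
      using order_tendstoD(2)[OF g_lim, of "e / 4"] e by simp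
    then obtain N where N: "\<And>n. n \<ge> N \<Longrightarrow> ?g n (4 ^ k *\<^sub>R (\<Sum>i\<le>m. x i)) < e / 4"
      by (auto simp: eventually_sequentially)
    obtain n where "n > max m N" "e \<le> ?g n (x n)"
      using ex_P by blast
    with N show "\<exists>n. True \<and> m < n \<and> e \<le> ?g n (x n) \<and> ?g n (4 ^ k *\<^sub>R (\<Sum>i\<le>m. x i)) < e / 4"
      by (intro exI[of _ n]) auto
  qed simp
  then obtain r where r: "\<And>k. r k < r (Suc k)" "\<And>k. e \<le> ?g (r (Suc k)) (x (r (Suc k)))"
      "\<And>k. ?g (r (Suc k)) (4 ^ k *\<^sub>R (\<Sum>i\<le>r k. x i)) < e / 4"
    by blast
  have r_mono: "strict_mono r"
    using r(1) by (simp add: strict_mono_Suc_iff)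
  \<comment> \<open>The vector actually subtracted uses the selected terms alone; it lies below the
    full sum controlled by the choice of \<open>r\<close>.\<close>
  define s where "s k = 4 ^ k *\<^sub>R (\<Sum>i\<le>k. x (r i))" for k
  have s: "0 \<le> s k" "s k \<le> 4 ^ k *\<^sub>R (\<Sum>i\<le>r k. x i)" for k
  proof -
    show "0 \<le> s k"
      unfolding s_def using x by (intro scaleR_nonneg_nonneg sum_nonneg) auto
    have "(\<Sum>i\<le>k. x (r i)) = sum x (r ` {..k})"
      using r_mono by (subst sum.reindex) (auto intro: strict_mono_imp_inj_on inj_on_subset)
    also have "\<dots> \<le> (\<Sum>i\<le>r k. x i)"
      using x r_mono by (intro sum_mono2) (auto simp: strict_mono_less_eq)
    finally show "s k \<le> 4 ^ k *\<^sub>R (\<Sum>i\<le>r k. x i)"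
      unfolding s_def by (intro scaleR_left_mono) auto
  qed
  have "bounded (range (\<lambda>n. x (r n)))"
    using A(1) x by (auto simp: almost_limited_def intro: bounded_subset)
  then obtain X where X: "0 \<le> X"
    and disj: "\<And>j k. j \<noteq> k \<Longrightarrow> inf (pprt (x (r (Suc j)) - s j - (1 / 2 ^ j) *\<^sub>R X))
          (pprt (x (r (Suc k)) - s k - (1 / 2 ^ k) *\<^sub>R X)) = 0"
    unfolding s_def using disjointification[of "\<lambda>n. x (r n)"] x(2) by blast
  define v where "v k = pprt (x (r (Suc k)) - s k - (1 / 2 ^ k) *\<^sub>R X)" for k
  have v0: "0 \<le> v k" for k
    by (simp add: v_def)
  have v_A: "v k \<in> A" for k
  proof -
    have "x (r (Suc k)) - s k - (1 / 2 ^ k) *\<^sub>R X \<le> x (r (Suc k))"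
      using s(1)[of k] X by (simp add: algebra_simps add_nonneg_nonneg scaleR_nonneg_nonneg)
    then have "v k \<le> x (r (Suc k))"
      using x by (simp add: v_def pprt_def)
    then have "\<bar>v k\<bar> \<le> \<bar>x (r (Suc k))\<bar>"
      using v0 x by simp
    with A(2) x(1) show ?thesis
      unfolding solid_def by blast
  qed
  have sub: "strict_mono (\<lambda>k. r (Suc k))"
    using r(1) by (simp add: strict_mono_Suc_iff)
  have "weak_star_null (\<lambda>k. dual_abs (f (r (Suc k))))"
    using LIMSEQ_subseq_LIMSEQ[OF g_lim sub] by (simp add: weak_star_null_iff o_def)
  then have "(\<lambda>k. ?g (r (Suc k)) (v k)) \<longlonglongrightarrow> 0"
    using v_A v0 disj unfolding v_def by (intro almost_limited_disjoint_uniform[OF A(1)])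
  then have "\<forall>\<^sub>F k in sequentially. ?g (r (Suc k)) (v k) < e / 2"
    using e by (intro order_tendstoD(2)) auto
  moreover have "\<forall>\<^sub>F k in sequentially. ?g (r (Suc k)) X < e / 4"
    using LIMSEQ_subseq_LIMSEQ[OF g_lim sub, of X] e by (intro order_tendstoD(2)) (auto simp: o_def)
  \<comment> \<open>Out of at least \<open>e\<close> at \<open>x (r (Suc k))\<close>, the overlaps
    \<open>s k\<close> and the multiple of \<open>X\<close> each remove less than
    \<open>e / 4\<close>. More than \<open>e / 2\<close> is left at \<open>v k\<close>.\<close>
  ultimately have "\<forall>\<^sub>F k :: nat in sequentially. False"
  proof eventually_elim
    case (elim k)
    let ?G = "?g (r (Suc k))"
    have "?G ((1 / 2 ^ k) *\<^sub>R X) \<le> ?G X"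
      using X scaleR_right_mono[of "1 / 2 ^ k" 1 X] by (intro dual_abs_mono) simp
    moreover have "?G (s k) < e / 4"
      using dual_abs_mono[OF s(2), of "f (r (Suc k))" k] r(3)[of k] by linarith
    moreover have "?G (x (r (Suc k)) - s k - (1 / 2 ^ k) *\<^sub>R X) \<le> ?G (v k)"
      by (intro dual_abs_mono) (simp add: v_def pprt_def)
    ultimately show False
      using elim r(2)[of k] by (simp add: blinfun.diff_right)
  qed
  then show False
    by simp
qed

section \<open>Composition with the operator and conclusion\<close>

lemma weak_star_null_dual_abs_compose:
  fixes T :: "'a::banach_lattice \<Rightarrow> 'b::banach_lattice"
  assumes "order_bounded_operator T" "weak_star_null (\<lambda>n. dual_abs (f n))"
  shows "weak_star_null (\<lambda>n. dual_abs (f n o\<^sub>L Blinfun T))"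
proof (rule weak_star_null_positive)
  fix x :: 'a assume x: "0 \<le> x"
  have T: "blinfun_apply (Blinfun T) = T"
    using order_bounded_operator_bounded_linear[OF assms(1)] by (rule bounded_linear_Blinfun_apply)
  \<comment> \<open>The bound \<open>z\<close> depends on \<open>x\<close> and \<open>T\<close> but
    not on \<open>n\<close>, so a single null sequence dominates the moduli at
    \<open>x\<close>.\<close>
  obtain z where z: "\<And>y. \<bar>y\<bar> \<le> x \<Longrightarrow> \<bar>T y\<bar> \<le> z"
    using order_bounded_operator_interval[OF assms(1)] by blast
  have upper: "blinfun_apply (dual_abs (f n o\<^sub>L Blinfun T)) x \<le> blinfun_apply (dual_abs (f n)) z" for n
    unfolding dual_abs_eq_modulus_on[OF x]
  proof (rule modulus_on_least[OF _ x])
    fix y assume "\<bar>y\<bar> \<le> x"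
    then have "blinfun_apply (dual_abs (f n)) \<bar>T y\<bar> \<le> blinfun_apply (dual_abs (f n)) z"
      by (intro dual_abs_mono z)
    then show "blinfun_apply (f n o\<^sub>L Blinfun T) y \<le> blinfun_apply (dual_abs (f n)) z"
      using abs_apply_le_dual_abs[of "f n" "T y"] by (simp add: T)
  qed simp
  show "(\<lambda>n. blinfun_apply (dual_abs (f n o\<^sub>L Blinfun T)) x) \<longlonglongrightarrow> 0"
  proof (rule tendsto_sandwich[OF _ _ tendsto_const])
    show "(\<lambda>n. blinfun_apply (dual_abs (f n)) z) \<longlonglongrightarrow> 0"
      using assms(2) by (simp add: weak_star_null_iff)
  qed (use x upper in \<open>auto intro!: always_eventually dual_abs_nonneg\<close>)
qed

theorem theorem2p3:
  fixes T :: "'e::banach_lattice \<Rightarrow> 'f::banach_lattice"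
    and A :: "'e set"
  assumes "order_bounded_operator T"
    and "almost_limited A"
    and "solid A"
    and "property_d TYPE('f)"
  shows "almost_limited (T ` A)"
  unfolding almost_limited_def
proof (intro conjI allI impI)
  have T: "bounded_linear T"
    using assms(1) by (rule order_bounded_operator_bounded_linear)
  show "bounded (T ` A)"
    using assms(2) T by (auto simp: almost_limited_def intro: bounded_linear_image)
  fix f :: "nat \<Rightarrow> 'f dual"
  assume "dual_disjoint_seq f \<and> weak_star_null f"
  with assms(4) have "weak_star_null (\<lambda>n. dual_abs (f n))"
    by (simp add: property_d_def)
  \<comment> \<open>Uniform convergence on the image is that of the compositions on
    \<open>A\<close>. These may fail to be disjoint, but only their moduli have to be weak* null
    here.\<close>
  with assms have "uniform_limit A (\<lambda>n x. blinfun_apply (f n o\<^sub>L Blinfun T) x) (\<lambda>x. 0) sequentially"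
    by (intro almost_limited_solid_uniform_limit weak_star_null_dual_abs_compose)
  then show "uniform_limit (T ` A) (\<lambda>n x. blinfun_apply (f n) x) (\<lambda>x. 0) sequentially"
    by (simp add: uniform_limit_iff bounded_linear_Blinfun_apply[OF T])
qed

end
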